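(* Let $F:\mathbb{E}^{n}\to\mathbb{H}^{n+1}\subset\mathbb{L}^{n+2}$ be an isometric immersion of a horosphere in the hyperbolic space, with unit normal vector field $N$ with positive mean curvature and all principal curvatures equal to $k=\pm1$. Then the solution to the IMCF by parallel hypersurfaces with initial condition $F$ is given by $$F^{t}(x)=\cosh\left(-k\frac{t}{n}\right)F(x)+\sinh\left(-k\frac{t}{n}\right)N(x),\qquad\forall t\in\mathbb{R},\ x\in\mathbb{E}^n,$$ i.e. it is an eternal solution. Moreover, for each $t\in\mathbb{R}$, $F^t(\mathbb{E}^n)$ is a horosphere, which converges to a point when $t\to-\infty$ and converges to the conformal boundary $\partial\mathbb{H}^{n+1}$ of $\mathbb{H}^{n+1}$ when $t\to+\infty$.
   Context: $\mathbb{H}^{n+1}=\{x\in\mathbb{L}^{n+2}: -x_1^2+\sum_{i=2}^{n+2}x_i^2=-1,\ x_1>0\}$ in Lorentz space $\mathbb{L}^{n+2}$. For an oriented hypersurface $F:M^n\to\mathbb{H}^{n+1}$ (an immersion) with unit normal $N$, the second fundamental form is $II_x(v,w)=-\langle dN_x(v),dF_x(w)\rangle$, the principal curvatures $k_1,\dots,k_n$ are its eigenvalues with respect to the induced metric, and the mean curvature is $H=\sum_{i=1}^n k_i$ (not averaged). "Inward" normal means the choice of unit normal for which $H>0$. A one-parameter family of hypersurfaces $F^t:M\to\mathbb{H}^{n+1}$, $t\in I$, with $I\subset\mathbb{R}$ an open interval containing $0$, is a solution to the inverse mean curvature flow (IMCF) with initial condition $F$ if $\frac{\partial F^t}{\partial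 t}(x)=-\frac{1}{H^t(x)}N^t(x)$ for all $(x,t)\in M\times I$ and $F^0=F$, where $H^t$ is the mean curvature of $F^t$ with respect to its inward unit normal $N^t$ and $H^t(x)>0$ for all $(x,t)$. It is a solution by parallel hypersurfaces if there is a (smooth) function $\mu:I\to\mathbb{R}$ such that $F^t(x)=\cosh(\mu(t))F(x)+\sinh(\mu(t))N(x)$ for all $t\in I$, $x\in M$; the unit normal of $F^t$ is then $N^t(x)=\sinh(\mu(t))F(x)+\cosh(\mu(t))N(x)$. The solution is eternal if $I=\mathbb{R}$. Let $G:\mathbb{H}^{n+1}\to\mathbb{B}^{n+1}$, $G(x_1,\dots,x_{n+2})=\frac{1}{x_1+1}(x_2,\dots,x_{n+1},-x_{n+2})$, be the isometry onto the Poincaré ball model (the open unit ball of $\mathbb{E}^{n+1}$ with metric $\frac{4}{(1-|x|^2)^2}\langle\cdot,\cdot\rangle$). The conformal boundary $\partial\mathbb{H}^{n+1}$ is the set of ideal points corresponding under $G$ to $\partial\mathbb{B}^{n+1}$. "$F^t(M)$ converges to $\partial\mathbb{H}^{n+1}$ when $t\to+\infty$" means that for every $x\in M$ the Euclidean norm satisfies $|G(F^t(x))|\to1$. "$F^t(M)$ converges to a point" means that there is a single point $p$ of the closed ball $\overline{\mathbb{B}^{n+1}}$ (possibly ideal) with $G(F^t(x))\to p$ for every $x\in M$. *)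

theory Defs
  imports "HOL-Analysis.Analysis"
begin

(* Lorentz space L^(n+2) with n = CARD('n): the coordinates (x_1, ..., x_(n+2)) are grouped as
   (x_1, (x_2, ..., x_(n+1)), x_(n+2)), so that "snd" is the projection to the Euclidean space
   E^(n+1) = real ^ 'n \<times> real, whose library norm and inner product are the Euclidean ones. *)

type_synonym 'n lorentz = "real \<times> (real ^ 'n) \<times> real"

definition lorentz_inner :: "'n::finite lorentz \<Rightarrow> 'n lorentz \<Rightarrow> real" where
  "lorentz_inner x y = - (fst x * fst y) + snd x \<bullet> snd y"

definition hyperbolic_space :: "'n::finite lorentz set" where
  "hyperbolic_space = {x. lorentz_inner x x = -1 \<and> fst x > 0}"

definition poincare_ball :: "'n::finite lorentz \<Rightarrow> (real ^ 'n) \<times> real" where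
  "poincare_ball = (\<lambda>(x0, y, z). (1 / (x0 + 1)) *\<^sub>R (y, - z))"

(* A horosphere is a nonempty section of the hyperboloid by an affine hyperplane orthogonal to a
   future-pointing lightlike vector; c < 0 is exactly the condition for nonemptiness. *)
definition horosphere :: "'n::finite lorentz set \<Rightarrow> bool" where
  "horosphere S \<longleftrightarrow>
     (\<exists>\<xi> c. lorentz_inner \<xi> \<xi> = 0 \<and> fst \<xi> > 0 \<and> c < 0 \<and>
            S = {x \<in> hyperbolic_space. lorentz_inner x \<xi> = c})"

(* C^k on an open set of a finite-dimensional space: all iterated directional derivatives up to
   order k exist (as Frechet derivatives) and those of order k are continuous. *)
primrec Ck_on :: "nat \<Rightarrow> ('a::real_normed_vector \<Rightarrow> 'b::real_normed_vector) \<Rightarrow> 'a set \<Rightarrow> bool" where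
  "Ck_on 0 f S \<longleftrightarrow> continuous_on S f"
| "Ck_on (Suc k) f S \<longleftrightarrow>
     (\<forall>x\<in>S. f differentiable (at x)) \<and>
     (\<forall>v. Ck_on k (\<lambda>x. frechet_derivative f (at x) v) S)"

definition smooth_on :: "'a set \<Rightarrow> ('a::real_normed_vector \<Rightarrow> 'b::real_normed_vector) \<Rightarrow> bool" where
  "smooth_on S f \<longleftrightarrow> (\<forall>k. Ck_on k f S)"

definition hypersurface :: "(real ^ 'n \<Rightarrow> 'n::finite lorentz) \<Rightarrow> bool" where
  "hypersurface F \<longleftrightarrow>
     smooth_on UNIV F \<and> (\<forall>x. F x \<in> hyperbolic_space) \<and>
     (\<forall>x. inj (frechet_derivative F (at x)))"

definition induced_metric ::
  "(real ^ 'n \<Rightarrow> 'n::finite lorentz) \<Rightarrow> real ^ 'n \<Rightarrow> real ^ 'n \<Rightarrow> real ^ 'n \<Rightarrow> real" where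
  "induced_metric F x v w =
     lorentz_inner (frechet_derivative F (at x) v) (frechet_derivative F (at x) w)"

definition isometric_immersion :: "(real ^ 'n \<Rightarrow> 'n::finite lorentz) \<Rightarrow> bool" where
  "isometric_immersion F \<longleftrightarrow> hypersurface F \<and> (\<forall>x v w. induced_metric F x v w = v \<bullet> w)"

(* lorentz_inner (F x) (N x) = 0 says that N x is tangent to hyperbolic space at F x. *)
definition unit_normal ::
  "(real ^ 'n \<Rightarrow> 'n::finite lorentz) \<Rightarrow> (real ^ 'n \<Rightarrow> 'n lorentz) \<Rightarrow> bool" where
  "unit_normal F N \<longleftrightarrow>
     smooth_on UNIV N \<and>
     (\<forall>x. lorentz_inner (F x) (N x) = 0 \<and> lorentz_inner (N x) (N x) = 1 \<and>
          (\<forall>v. lorentz_inner (frechet_derivative F (at x) v) (N x) = 0))"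

definition second_fundamental_form ::
  "(real ^ 'n \<Rightarrow> 'n::finite lorentz) \<Rightarrow> (real ^ 'n \<Rightarrow> 'n lorentz) \<Rightarrow>
   real ^ 'n \<Rightarrow> real ^ 'n \<Rightarrow> real ^ 'n \<Rightarrow> real" where
  "second_fundamental_form F N x v w =
     - lorentz_inner (frechet_derivative N (at x) v) (frechet_derivative F (at x) w)"

(* The family \<kappa> lists the principal curvatures at x with multiplicity: the eigenvalues of the second
   fundamental form with respect to the induced metric, along an orthonormal basis e of principal
   directions. It is unique up to reordering. *)
definition principal_curvatures ::
  "(real ^ 'n \<Rightarrow> 'n::finite lorentz) \<Rightarrow> (real ^ 'n \<Rightarrow> 'n lorentz) \<Rightarrow>
   real ^ 'n \<Rightarrow> ('n \<Rightarrow> real) \<Rightarrow> bool" where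
  "principal_curvatures F N x \<kappa> \<longleftrightarrow>
     (\<exists>e :: 'n \<Rightarrow> real ^ 'n.
        (\<forall>i j. induced_metric F x (e i) (e j) = (if i = j then 1 else 0)) \<and>
        (\<forall>i w. second_fundamental_form F N x (e i) w = \<kappa> i * induced_metric F x (e i) w))"

definition mean_curvature ::
  "(real ^ 'n \<Rightarrow> 'n::finite lorentz) \<Rightarrow> (real ^ 'n \<Rightarrow> 'n lorentz) \<Rightarrow> real ^ 'n \<Rightarrow> real" where
  "mean_curvature F N x = (THE h. \<exists>\<kappa>. principal_curvatures F N x \<kappa> \<and> h = (\<Sum>i\<in>UNIV. \<kappa> i))"

definition inward_unit_normal ::
  "(real ^ 'n \<Rightarrow> 'n::finite lorentz) \<Rightarrow> (real ^ 'n \<Rightarrow> 'n lorentz) \<Rightarrow> bool" where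
  "inward_unit_normal F N \<longleftrightarrow> unit_normal F N \<and> (\<forall>x. mean_curvature F N x > 0)"

definition imcf_solution ::
  "real set \<Rightarrow> (real \<Rightarrow> real ^ 'n \<Rightarrow> 'n::finite lorentz) \<Rightarrow> (real ^ 'n \<Rightarrow> 'n lorentz) \<Rightarrow> bool" where
  "imcf_solution I Ft F \<longleftrightarrow>
     open I \<and> is_interval I \<and> 0 \<in> I \<and>
     (\<forall>t\<in>I. hypersurface (Ft t)) \<and>
     Ft 0 = F \<and>
     (\<forall>t\<in>I. \<exists>Nt. inward_unit_normal (Ft t) Nt \<and>
        (\<forall>x. ((\<lambda>s. Ft s x) has_vector_derivative
                 - ((1 / mean_curvature (Ft t) Nt x) *\<^sub>R Nt x)) (at t)))"

(* N is only a reference unit normal of F; the inward normals in the flow equation may be opposite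
   to the ones induced by N. *)
definition imcf_solution_by_parallel ::
  "real set \<Rightarrow> (real \<Rightarrow> real ^ 'n \<Rightarrow> 'n::finite lorentz) \<Rightarrow>
   (real ^ 'n \<Rightarrow> 'n lorentz) \<Rightarrow> (real ^ 'n \<Rightarrow> 'n lorentz) \<Rightarrow> bool" where
  "imcf_solution_by_parallel I Ft F N \<longleftrightarrow>
     imcf_solution I Ft F \<and>
     (\<exists>\<mu> :: real \<Rightarrow> real. smooth_on I \<mu> \<and>
        (\<forall>t\<in>I. \<forall>x. Ft t x = cosh (\<mu> t) *\<^sub>R F x + sinh (\<mu> t) *\<^sub>R N x))"

definition converges_to_point ::
  "(real \<Rightarrow> real ^ 'n \<Rightarrow> 'n::finite lorentz) \<Rightarrow> real filter \<Rightarrow> bool" where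
  "converges_to_point Ft l \<longleftrightarrow>
     (\<exists>p \<in> cball 0 1. \<forall>x. ((\<lambda>t. poincare_ball (Ft t x)) \<longlongrightarrow> p) l)"

definition converges_to_conformal_boundary ::
  "(real \<Rightarrow> real ^ 'n \<Rightarrow> 'n::finite lorentz) \<Rightarrow> real filter \<Rightarrow> bool" where
  "converges_to_conformal_boundary Ft l \<longleftrightarrow>
     (\<forall>x. ((\<lambda>t. norm (poincare_ball (Ft t x))) \<longlongrightarrow> 1) l)"

end

theory Submission
  imports Defs "HOL-Real_Asymp.Real_Asymp"
begin

text \<open>
  The whole argument rests on one constant vector. At every point all principal curvatures equal
  \<open>k\<close>, so \<open>dN = - k dF\<close> (lemma \<open>umbilic_derivative_normal\<close>), and \<open>k\<^sup>2 = 1\<close> makes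
  \<open>\<xi> = F + k N\<close> constant (\<open>center_eq\<close>). The inner products \<open>\<langle>F, F\<rangle> = -1\<close>, \<open>\<langle>F, N\<rangle> = 0\<close>,
  \<open>\<langle>N, N\<rangle> = 1\<close> show that \<open>\<xi>\<close> is lightlike and that \<open>\<langle>F, \<xi>\<rangle> = -1\<close>: it spans the ray of the ideal
  point at which the horosphere is centred.

  Eliminating \<open>N\<close> turns the parallel hypersurface at signed distance \<open>\<mu>\<close> and its normal into
  affine images of \<open>F\<close>,
  \<open>P = exp (- k \<mu>) F + k sinh \<mu> \<xi>\<close> and \<open>Q = - k exp (- k \<mu>) F + k cosh \<mu> \<xi>\<close>
  (\<open>parallel_eq\<close>, \<open>parallel_normal_eq\<close>). Therefore \<open>dQ = - k dP\<close>: every parallel hypersurface again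
  has all principal curvatures equal to \<open>k\<close>, hence mean curvature \<open>n k\<close>, and its inward unit normal
  is \<open>k Q\<close>, with mean curvature \<open>n\<close>. As \<open>dP/d\<mu> = Q\<close>, the flow equation for \<open>P\<close> at distance
  \<open>\<mu>(t)\<close> reads \<open>\<mu>' Q = - (k/n) Q\<close>. Together with \<open>\<mu>(0) = 0\<close> it has exactly one solution,
  \<open>\<mu>(t) = - k t / n\<close>. For uniqueness it must be excluded that a competing solution uses a normal
  whose sign varies from point to point; this is \<open>unit_normal_unique\<close>, a continuity argument.

  The affine map that carries \<open>F\<close> to \<open>P\<close> moves the section \<open>\<langle>x, \<xi>\<rangle> = -1\<close> of the hyperboloid onto
  the section \<open>\<langle>x, \<xi>\<rangle> = - exp (- k \<mu>)\<close>, so all these hypersurfaces are horospheres with the same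
  centre (\<open>horosphere_parallel\<close>). Along the flow,
  \<open>P = exp (t/n) F - sinh (t/n) \<xi>\<close>. For \<open>t \<rightarrow> -\<infinity>\<close> the term in \<open>\<xi>\<close> dominates and every
  point tends to the ideal point of \<open>\<xi>\<close>; for \<open>t \<rightarrow> \<infinity>\<close> the first coordinate grows like
  \<open>exp (t/n)\<close> times the first coordinate of \<open>F - \<xi>/2\<close>, which is positive because this vector is
  lightlike and future-pointing, and an unbounded first coordinate means approach to the boundary
  of the ball.
\<close>

section \<open>Lorentzian linear algebra\<close>

lemma bounded_bilinear_lorentz_inner: "bounded_bilinear (lorentz_inner :: 'n::finite lorentz \<Rightarrow> _)"
  by (subst bilinear_conv_bounded_bilinear[symmetric])
     (auto simp: bilinear_def lorentz_inner_def inner_add_left inner_add_right algebra_simps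
           intro!: linearI)

interpretation lorentz: bounded_bilinear "lorentz_inner :: 'n::finite lorentz \<Rightarrow> _"
  by (rule bounded_bilinear_lorentz_inner)

lemmas lorentz_simps = lorentz.add_left lorentz.add_right lorentz.scaleR_left lorentz.scaleR_right
  lorentz.diff_left lorentz.diff_right lorentz.minus_left lorentz.minus_right
  lorentz.zero_left lorentz.zero_right

lemma lorentz_inner_commute: "lorentz_inner x y = lorentz_inner y x"
  by (simp add: lorentz_inner_def inner_commute mult.commute)

text \<open>Pairing \<open>u\<close> with its own time reflection yields the Euclidean square of its norm.\<close>

lemma lorentz_nondegenerate:
  assumes "\<And>y. lorentz_inner u y = 0"
  shows "u = 0"
proof -
  have "lorentz_inner u (- fst u, snd u) = 0" by (rule assms)
  then have "fst u * fst u + snd u \<bullet> snd u = 0" by (simp add: lorentz_inner_def)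
  then have "fst u * fst u = 0" "snd u \<bullet> snd u = 0"
    by (smt (verit) inner_ge_zero zero_le_square)+
  then show ?thesis by (simp add: prod_eq_iff)
qed

text \<open>
  Two causal vectors in opposite closed half-cones have nonnegative product, by Cauchy-Schwarz in the
  space coordinates. This decides membership in the upper sheet of the hyperboloid from the sign of
  an inner product alone.
\<close>

lemma causal_future_pointing:
  assumes v: "lorentz_inner v v \<le> 0" and w: "lorentz_inner w w \<le> 0" "fst w > 0"
    and vw: "lorentz_inner v w < 0"
  shows "fst v > 0"
proof (rule ccontr)
  assume neg: "\<not> fst v > 0"
  have "(norm (snd v))\<^sup>2 \<le> (- fst v)\<^sup>2" "(norm (snd w))\<^sup>2 \<le> (fst w)\<^sup>2"
    using v w by (simp_all add: lorentz_inner_def power2_norm_eq_inner) (simp_all add: power2_eq_square)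
  then have "norm (snd v) \<le> - fst v" "norm (snd w) \<le> fst w"
    using neg w(2) power2_le_imp_le[of "norm (snd v)" "- fst v"] power2_le_imp_le[of "norm (snd w)" "fst w"]
    by simp_all
  then have "norm (snd v) * norm (snd w) \<le> - fst v * fst w"
    using neg by (intro mult_mono) auto
  moreover have "- (norm (snd v) * norm (snd w)) \<le> snd v \<bullet> snd w"
    using Cauchy_Schwarz_ineq2[of "snd v" "snd w"] by linarith
  ultimately show False using vw by (simp add: lorentz_inner_def)
qed

text \<open>
  A point \<open>p\<close> of the hyperboloid, a unit normal \<open>q\<close> and the tangent space of a hypersurface have
  dimensions that add up to that of the ambient space. Since \<open>p\<close> and \<open>q\<close> are not null and orthogonal
  to everything else, the combination map is injective, and an injective linear endomorphism of a
  finite-dimensional space is onto.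
\<close>

lemma adapted_frame_spans:
  fixes L :: "real ^ 'n \<Rightarrow> 'n::finite lorentz"
  assumes pq: "lorentz_inner p p = -1" "lorentz_inner q q = 1" "lorentz_inner p q = 0"
    and L: "linear L" "inj L"
    and perp: "\<And>v. lorentz_inner (L v) p = 0" "\<And>v. lorentz_inner (L v) q = 0"
  obtains a v b where "u = a *\<^sub>R p + L v + b *\<^sub>R q"
proof -
  define T :: "'n lorentz \<Rightarrow> 'n lorentz"
    where "T = (\<lambda>y. fst y *\<^sub>R p + L (fst (snd y)) + snd (snd y) *\<^sub>R q)"
  have "linear T"
    unfolding T_def by (rule linearI) (simp_all add: linear_add[OF L(1)] linear_cmul[OF L(1)] algebra_simps)
  moreover have "inj T"
  proof (subst linear_injective_0[OF \<open>linear T\<close>], intro allI impI)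
    fix y assume y: "T y = 0"
    have "lorentz_inner (T y) p = - fst y" "lorentz_inner (T y) q = snd (snd y)"
      using pq perp by (simp_all add: T_def lorentz_simps lorentz_inner_commute[of q p])
    then have *: "fst y = 0" "snd (snd y) = 0" using y by (simp_all add: lorentz_simps)
    then have "L (fst (snd y)) = 0" using y by (simp add: T_def)
    then have "fst (snd y) = 0" using L linear_injective_0 by blast
    with * show "y = 0" by (simp add: prod_eq_iff)
  qed
  ultimately have "surj T" by (rule linear_inj_imp_surj)
  then obtain y where "u = T y" by (metis surjD)
  then show thesis using that unfolding T_def by blast
qed

lemma orthogonal_adapted_frame_imp_zero:
  fixes L :: "real ^ 'n \<Rightarrow> 'n::finite lorentz"
  assumes "lorentz_inner p p = -1" "lorentz_inner q q = 1" "lorentz_inner p q = 0"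
    and "linear L" "inj L"
    and "\<And>v. lorentz_inner (L v) p = 0" "\<And>v. lorentz_inner (L v) q = 0"
    and u: "lorentz_inner u p = 0" "lorentz_inner u q = 0" "\<And>v. lorentz_inner u (L v) = 0"
  shows "u = 0"
proof (rule lorentz_nondegenerate)
  fix y
  obtain a v b where "y = a *\<^sub>R p + L v + b *\<^sub>R q"
    using adapted_frame_spans[OF assms(1-7)] by blast
  then show "lorentz_inner u y = 0" by (simp add: lorentz_simps u)
qed

section \<open>Smooth maps and unit normals\<close>

lemma frechet_derivative_affine:
  assumes "f differentiable (at x)"
  shows "frechet_derivative (\<lambda>x. a *\<^sub>R f x + c) (at x) = (\<lambda>v. a *\<^sub>R frechet_derivative f (at x) v)"
proof -
  have "((\<lambda>x. a *\<^sub>R f x + c) has_derivative (\<lambda>v. a *\<^sub>R frechet_derivative f (at x) v)) (at x)"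
    using assms by (auto intro!: derivative_eq_intros simp: frechet_derivative_works)
  then show ?thesis by (rule frechet_derivative_at[symmetric])
qed

text \<open>
  The parallel hypersurfaces and their normals are all of this affine form, which is the only way in
  which smooth maps have to be combined.
\<close>

lemma Ck_on_affine:
  assumes "Ck_on k f UNIV"
  shows "Ck_on k (\<lambda>x. a *\<^sub>R f x + c) UNIV"
  using assms
proof (induction k arbitrary: f c)
  case 0
  then show ?case by (auto intro!: continuous_intros)
next
  case (Suc k)
  have d: "f differentiable (at x)" for x using Suc.prems by simp
  have "Ck_on k (\<lambda>x. frechet_derivative (\<lambda>x. a *\<^sub>R f x + c) (at x) v) UNIV" for v
    using Suc.IH[of "\<lambda>x. frechet_derivative f (at x) v" 0] Suc.prems
    by (simp add: frechet_derivative_affine[OF d])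
  then show ?case using d by auto
qed

lemma smooth_on_affine: "smooth_on UNIV f \<Longrightarrow> smooth_on UNIV (\<lambda>x. a *\<^sub>R f x + c)"
  by (simp add: smooth_on_def Ck_on_affine)

lemma smooth_on_imp_differentiable: "smooth_on S f \<Longrightarrow> x \<in> S \<Longrightarrow> f differentiable (at x)"
  unfolding smooth_on_def by (metis Ck_on.simps(2))

lemma Ck_on_const: "Ck_on k (\<lambda>x. c) S"
  by (induction k arbitrary: c) auto

lemma smooth_on_ident: "smooth_on UNIV (\<lambda>x :: 'a::real_normed_vector. x)"
proof -
  have "Ck_on k (\<lambda>x :: 'a. x) UNIV" for k
    by (cases k) (auto simp: Ck_on_const)
  then show ?thesis by (simp add: smooth_on_def)
qed

lemma hypersurface_has_derivative:
  "hypersurface F \<Longrightarrow> (F has_derivative frechet_derivative F (at x)) (at x)"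
  using smooth_on_imp_differentiable frechet_derivative_works
  unfolding hypersurface_def by blast

lemma unit_normal_has_derivative:
  "unit_normal F N \<Longrightarrow> (N has_derivative frechet_derivative N (at x)) (at x)"
  using smooth_on_imp_differentiable frechet_derivative_works
  unfolding unit_normal_def by blast

lemma derivative_lorentz_inner_const:
  assumes f: "(f has_derivative f') (at x)" and g: "(g has_derivative g') (at x)"
    and const: "\<And>y. lorentz_inner (f y) (g y) = c"
  shows "lorentz_inner (f' v) (g x) + lorentz_inner (f x) (g' v) = 0"
proof -
  have "(\<lambda>v. lorentz_inner (f x) (g' v) + lorentz_inner (f' v) (g x)) = (\<lambda>v. 0)"
    using lorentz.FDERIV[OF f g] unfolding const
    by (rule has_derivative_unique) (rule has_derivative_const)
  from fun_cong[OF this, of v] show ?thesis by simp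
qed

lemma hypersurface_derivative_tangent:
  assumes F: "hypersurface F"
  shows "lorentz_inner (frechet_derivative F (at x) v) (F x) = 0"
proof -
  have "lorentz_inner (F y) (F y) = -1" for y
    using F by (simp add: hypersurface_def hyperbolic_space_def)
  from derivative_lorentz_inner_const[OF hypersurface_has_derivative[OF F]
      hypersurface_has_derivative[OF F] this, of x v]
  show ?thesis by (simp add: lorentz_inner_commute)
qed

text \<open>
  Vector identities along a hypersurface are verified by testing against its point, its normal and
  its tangent vectors.
\<close>

lemma hypersurface_orthogonal_imp_zero:
  assumes F: "hypersurface F" and N: "unit_normal F N"
    and u: "lorentz_inner u (F x) = 0" "lorentz_inner u (N x) = 0"
      "\<And>v. lorentz_inner u (frechet_derivative F (at x) v) = 0"
  shows "u = 0"
proof -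
  have hyp: "lorentz_inner (F x) (F x) = -1"
    using F by (simp add: hypersurface_def hyperbolic_space_def)
  have lin: "linear (frechet_derivative F (at x))"
    using hypersurface_has_derivative[OF F] by (rule has_derivative_linear)
  show ?thesis
    by (rule orthogonal_adapted_frame_imp_zero[of "F x" "N x" "frechet_derivative F (at x)"])
       (use F N hypersurface_derivative_tangent[OF F] u hyp lin in \<open>auto simp: hypersurface_def unit_normal_def\<close>)
qed

text \<open>
  Testing against the frame gives \<open>N' = \<langle>N', N\<rangle> N\<close>. The factor is continuous with values in
  \<open>{1, -1}\<close>, so connectedness of the parameter domain makes the sign the same at all points.
\<close>

lemma unit_normal_unique:
  assumes F: "hypersurface F" and N: "unit_normal F N" and N': "unit_normal F N'"
  obtains s :: real where "s = 1 \<or> s = -1" "\<And>x. N' x = s *\<^sub>R N x"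
proof -
  define s where "s = (\<lambda>x. lorentz_inner (N' x) (N x))"
  have eq: "N' x = s x *\<^sub>R N x" for x
  proof -
    have "N' x - s x *\<^sub>R N x = 0"
      by (rule hypersurface_orthogonal_imp_zero[OF F N, of _ x])
         (use N N' in \<open>auto simp: unit_normal_def lorentz_simps s_def lorentz_inner_commute\<close>)
    then show ?thesis by simp
  qed
  have sq: "s x = 1 \<or> s x = -1" for x
  proof -
    have "lorentz_inner (N' x) (N' x) = 1" "lorentz_inner (N x) (N x) = 1"
      using N N' by (auto simp: unit_normal_def)
    then have "s x * s x = 1" by (simp add: eq[of x] lorentz_simps)
    then show ?thesis by (simp add: square_eq_1_iff)
  qed
  have "continuous_on UNIV N" "continuous_on UNIV N'"
    using N N' unfolding unit_normal_def smooth_on_def by (metis Ck_on.simps(1))+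
  then have "continuous_on UNIV s" unfolding s_def by (intro lorentz.continuous_on)
  moreover have "finite (range s)"
    by (rule finite_subset[of _ "{1,-1}"]) (use sq in auto)
  ultimately obtain c where "\<And>x. s x = c"
    using continuous_finite_range_constant[of UNIV s] by (auto simp: constant_on_def)
  with sq eq that show thesis by metis
qed

section \<open>Umbilic points\<close>

text \<open>
  The hypothesis speaks of the vectors of one frame only; a frame orthonormal for the induced metric
  is linearly independent, hence a basis, and bilinearity does the rest.
\<close>

lemma umbilic_second_fundamental_form:
  assumes F: "hypersurface F" and N: "unit_normal F N"
    and pc: "principal_curvatures F N x (\<lambda>_. k)"
  shows "second_fundamental_form F N x v w = k * induced_metric F x v w"
proof -
  obtain e :: "'a \<Rightarrow> real ^ 'a" where
    e: "\<And>i j. induced_metric F x (e i) (e j) = (if i = j then 1 else 0)"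
    and II: "\<And>i w. second_fundamental_form F N x (e i) w = k * induced_metric F x (e i) w"
    using pc unfolding principal_curvatures_def by blast
  have lin: "linear (frechet_derivative F (at x))" "linear (frechet_derivative N (at x))"
    using F N smooth_on_imp_differentiable linear_frechet_derivative
    unfolding hypersurface_def unit_normal_def by blast+
  define A where "A = (\<lambda>c :: real ^ 'a. \<Sum>i\<in>UNIV. c $ i *\<^sub>R e i)"
  have "linear A"
    unfolding A_def by (rule linearI) (simp_all add: algebra_simps sum.distrib scaleR_sum_right)
  moreover have g: "induced_metric F x (A c) u = (\<Sum>i\<in>UNIV. c $ i * induced_metric F x (e i) u)" for c u
    unfolding induced_metric_def A_def
    by (simp add: linear_sum[OF lin(1)] linear_cmul[OF lin(1)] lorentz.sum_left lorentz_simps)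
  have "inj A"
  proof (subst linear_injective_0[OF \<open>linear A\<close>], intro allI impI)
    fix c assume "A c = 0"
    then have "induced_metric F x (A c) (e j) = 0" for j
      by (simp add: induced_metric_def linear_0[OF lin(1)] lorentz_simps)
    then have "c $ j = 0" for j
      by (simp add: g e if_distrib[of "\<lambda>t. _ * t"] cong: if_cong)
    then show "c = 0" by (simp add: vec_eq_iff)
  qed
  ultimately have "surj A" using linear_injective_imp_surjective by blast
  then obtain c where v: "v = A c" by (metis surjD)
  have "second_fundamental_form F N x (A c) w
      = (\<Sum>i\<in>UNIV. c $ i * second_fundamental_form F N x (e i) w)"
    unfolding second_fundamental_form_def A_def
    by (simp add: linear_sum[OF lin(2)] linear_cmul[OF lin(2)] lorentz.sum_left lorentz_simps sum_negf)
  then show ?thesis by (simp add: v II g sum_distrib_left mult.left_commute)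
qed

text \<open>
  The tangential part of \<open>dN\<close> is prescribed by the second fundamental form. Differentiating
  \<open>\<langle>F, N\<rangle> = 0\<close> and \<open>\<langle>N, N\<rangle> = 1\<close> shows that the components along \<open>F\<close> and \<open>N\<close> vanish.
\<close>

lemma umbilic_derivative_normal:
  assumes F: "hypersurface F" and N: "unit_normal F N"
    and pc: "principal_curvatures F N x (\<lambda>_. k)"
  shows "frechet_derivative N (at x) v = - k *\<^sub>R frechet_derivative F (at x) v"
proof -
  let ?dF = "frechet_derivative F (at x)" and ?dN = "frechet_derivative N (at x)"
  note dF = hypersurface_has_derivative[OF F] and dN = unit_normal_has_derivative[OF N]
  have c: "lorentz_inner (F y) (F y) = -1" "lorentz_inner (F y) (N y) = 0"
    "lorentz_inner (N y) (N y) = 1" "lorentz_inner (?dF v) (N x) = 0" for y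
    using F N by (auto simp: hypersurface_def hyperbolic_space_def unit_normal_def)
  have 1: "lorentz_inner (?dF v) (F x) = 0"
    by (rule hypersurface_derivative_tangent[OF F])
  have 2: "lorentz_inner (?dN v) (F x) = 0"
    using derivative_lorentz_inner_const[OF dF dN c(2), of x v] c(4) by (simp add: lorentz_inner_commute)
  have 3: "lorentz_inner (?dN v) (N x) = 0"
    using derivative_lorentz_inner_const[OF dN dN c(3), of x v] by (simp add: lorentz_inner_commute)
  have "?dN v + k *\<^sub>R ?dF v = 0"
  proof (rule hypersurface_orthogonal_imp_zero[OF F N, of _ x])
    fix w
    show "lorentz_inner (?dN v + k *\<^sub>R ?dF v) (?dF w) = 0"
      using umbilic_second_fundamental_form[OF assms, of v w]
      by (simp add: second_fundamental_form_def induced_metric_def lorentz_simps)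
  qed (simp_all add: lorentz_simps 1 2 3 c)
  then show ?thesis by (simp add: add_eq_0_iff)
qed

text \<open>
  The description by \<open>THE\<close> in the definition of the mean curvature is legitimate here: any other list
  of principal curvatures is constantly \<open>k\<close>, because on a unit vector of its frame the second
  fundamental form takes the value \<open>k\<close>.
\<close>

lemma umbilic_mean_curvature:
  fixes F :: "real ^ 'n \<Rightarrow> 'n::finite lorentz"
  assumes "hypersurface F" and "unit_normal F N"
    and "principal_curvatures F N x (\<lambda>_. k)"
  shows "mean_curvature F N x = real CARD('n) * k"
  unfolding mean_curvature_def
proof (rule the_equality)
  show "\<exists>\<kappa>. principal_curvatures F N x \<kappa> \<and> real CARD('n) * k = (\<Sum>i\<in>UNIV. \<kappa> i)"
    using assms(3) by (intro exI[of _ "\<lambda>_. k"]) simp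
next
  fix h assume "\<exists>\<kappa>. principal_curvatures F N x \<kappa> \<and> h = (\<Sum>i\<in>UNIV. \<kappa> i)"
  then obtain \<kappa> where "principal_curvatures F N x \<kappa>" and h: "h = (\<Sum>i\<in>UNIV. \<kappa> i)" by blast
  then obtain e :: "'n \<Rightarrow> real ^ 'n" where
    "\<And>i j. induced_metric F x (e i) (e j) = (if i = j then 1 else 0)"
    "\<And>i w. second_fundamental_form F N x (e i) w = \<kappa> i * induced_metric F x (e i) w"
    unfolding principal_curvatures_def by blast
  then have "\<kappa> i = k" for i
    using umbilic_second_fundamental_form[OF assms, of "e i" "e i"] by simp
  then show "h = real CARD('n) * k" by (simp add: h)
qed

text \<open>
  Derivatives of affine images are rescaled by \<open>a\<close> and \<open>b\<close>. For an isometric \<open>F\<close> the coordinate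
  vectors, divided by \<open>a\<close>, are then an orthonormal frame of principal directions.
\<close>

lemma principal_curvatures_affine:
  assumes F: "isometric_immersion F" and a: "a > 0"
  shows "principal_curvatures (\<lambda>x. a *\<^sub>R F x + u) (\<lambda>x. b *\<^sub>R F x + w) x (\<lambda>_. - b / a)"
proof -
  have d: "F differentiable (at x)"
    using F smooth_on_imp_differentiable unfolding isometric_immersion_def hypersurface_def by blast
  have m: "lorentz_inner (frechet_derivative F (at x) y) (frechet_derivative F (at x) z) = y \<bullet> z" for y z
    using F by (simp add: isometric_immersion_def induced_metric_def)
  have g: "induced_metric (\<lambda>x. a *\<^sub>R F x + u) x y z = a * a * (y \<bullet> z)" for y z
    unfolding induced_metric_def frechet_derivative_affine[OF d] by (simp add: lorentz_simps m)
  have II: "second_fundamental_form (\<lambda>x. a *\<^sub>R F x + u) (\<lambda>x. b *\<^sub>R F x + w) x y z = - (b * a) * (y \<bullet> z)" for y z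
    unfolding second_fundamental_form_def frechet_derivative_affine[OF d] by (simp add: lorentz_simps m)
  show ?thesis
    unfolding principal_curvatures_def g II
    using a by (intro exI[of _ "\<lambda>i. (1 / a) *\<^sub>R axis i 1"]) (auto simp: inner_axis_axis)
qed

section \<open>Parallel hypersurfaces of a horospherical immersion\<close>

locale horospherical_immersion =
  fixes F N :: "real ^ 'n \<Rightarrow> 'n::finite lorentz" and k :: real
  assumes isom: "isometric_immersion F" and normal: "unit_normal F N"
    and k: "k = 1 \<or> k = -1"
    and curvatures: "\<And>x. principal_curvatures F N x (\<lambda>_. k)"
begin

definition parallel :: "real \<Rightarrow> real ^ 'n \<Rightarrow> 'n lorentz" where
  "parallel m x = cosh m *\<^sub>R F x + sinh m *\<^sub>R N x"

definition parallel_normal :: "real \<Rightarrow> real ^ 'n \<Rightarrow> 'n lorentz" where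
  "parallel_normal m x = sinh m *\<^sub>R F x + cosh m *\<^sub>R N x"

text \<open>
  The lightlike vector whose ray is the ideal centre of the horosphere; the base point \<open>0\<close> is
  arbitrary.
\<close>
definition center :: "'n lorentz" where
  "center = F 0 + k *\<^sub>R N 0"

lemma hyp: "hypersurface F"
  using isom by (simp add: isometric_immersion_def)

lemma k_sq: "k * k = 1"
  using k by auto

lemma products:
  "lorentz_inner (F x) (F x) = -1" "lorentz_inner (F x) (N x) = 0"
  "lorentz_inner (N x) (F x) = 0" "lorentz_inner (N x) (N x) = 1"
  using hyp normal
  by (auto simp: hypersurface_def hyperbolic_space_def unit_normal_def lorentz_inner_commute[of "N x"])

lemmas dF = hypersurface_has_derivative[OF hyp] and dN = unit_normal_has_derivative[OF normal]

text \<open>Its derivative is \<open>dF + k dN = (1 - k\<^sup>2) dF = 0\<close>.\<close>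

lemma center_eq: "F x + k *\<^sub>R N x = center"
proof -
  have "((\<lambda>x. F x + k *\<^sub>R N x) has_derivative (\<lambda>v. 0)) (at y within UNIV)" for y
  proof -
    have "((\<lambda>x. F x + k *\<^sub>R N x) has_derivative
      (\<lambda>v. frechet_derivative F (at y) v + k *\<^sub>R frechet_derivative N (at y) v)) (at y)"
      by (intro derivative_intros dF dN)
    then show ?thesis
      by (simp add: umbilic_derivative_normal[OF hyp normal curvatures] k_sq)
  qed
  then obtain c where "\<And>y. F y + k *\<^sub>R N y = c"
    using has_derivative_zero_constant[of UNIV "\<lambda>x. F x + k *\<^sub>R N x"] by auto
  then show ?thesis by (simp add: center_def)
qed

lemma N_eq: "N x = k *\<^sub>R (center - F x)"
  by (simp add: center_eq[of x, symmetric] k_sq)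

lemma center_lightlike: "lorentz_inner center center = 0"
  by (simp add: center_def lorentz_simps products k_sq)

lemma F_center: "lorentz_inner (F x) center = -1"
  by (simp add: center_eq[of x, symmetric] lorentz_simps products)

lemma center_future: "fst center > 0"
proof (rule causal_future_pointing[of _ "F 0"])
  show "fst (F 0) > 0" using hyp by (simp add: hypersurface_def hyperbolic_space_def)
  show "lorentz_inner center (F 0) < 0" using F_center lorentz_inner_commute[of center] by simp
qed (simp_all add: center_lightlike products)

lemma cosh_sinh_k: "cosh m - k * sinh m = exp (- k * m)"
  using k cosh_minus_sinh[of m] cosh_plus_sinh[of m] by auto

text \<open>
  Eliminating the normal exhibits parallel displacement as a homothety followed by a translation in
  the fixed lightlike direction.
\<close>

lemma parallel_eq: "parallel m x = exp (- k * m) *\<^sub>R F x + (k * sinh m) *\<^sub>R center"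
proof -
  have "parallel m x = (cosh m - k * sinh m) *\<^sub>R F x + (k * sinh m) *\<^sub>R center"
    by (simp add: parallel_def N_eq algebra_simps)
  then show ?thesis by (simp only: cosh_sinh_k)
qed

lemma parallel_normal_eq:
  "parallel_normal m x = (- k * exp (- k * m)) *\<^sub>R F x + (k * cosh m) *\<^sub>R center"
proof -
  have "sinh m - k * cosh m = - k * exp (- k * m)"
    unfolding cosh_sinh_k[symmetric] using k by auto
  moreover have "parallel_normal m x = (sinh m - k * cosh m) *\<^sub>R F x + (k * cosh m) *\<^sub>R center"
    by (simp add: parallel_normal_def N_eq algebra_simps)
  ultimately show ?thesis by simp
qed

lemma parallel_center: "lorentz_inner (parallel m x) center = - exp (- k * m)"
  by (simp add: parallel_eq lorentz_simps F_center center_lightlike)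

lemma parallel_in_hyperbolic_space: "parallel m x \<in> hyperbolic_space"
proof -
  have "lorentz_inner (parallel m x) (parallel m x) = - ((cosh m)\<^sup>2 - (sinh m)\<^sup>2)"
    by (simp add: parallel_def lorentz_simps products power2_eq_square)
  then have norm: "lorentz_inner (parallel m x) (parallel m x) = -1"
    by (simp add: cosh_square_eq)
  moreover have "fst (parallel m x) > 0"
    by (rule causal_future_pointing[of _ center])
       (simp_all add: norm center_lightlike center_future parallel_center)
  ultimately show ?thesis by (simp add: hyperbolic_space_def)
qed

lemma frechet_derivative_parallel:
  "frechet_derivative (parallel m) (at x) = (\<lambda>v. exp (- k * m) *\<^sub>R frechet_derivative F (at x) v)"
  unfolding parallel_eq[abs_def]
  by (rule frechet_derivative_affine) (use dF differentiable_def in blast)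

lemma hypersurface_parallel: "hypersurface (parallel m)"
proof -
  have "smooth_on UNIV (parallel m)"
    unfolding parallel_eq[abs_def] using hyp
    by (intro smooth_on_affine) (simp add: hypersurface_def)
  moreover have "inj (frechet_derivative (parallel m) (at x))" for x
    using hyp by (simp add: hypersurface_def frechet_derivative_parallel inj_def)
  ultimately show ?thesis
    by (simp add: hypersurface_def parallel_in_hyperbolic_space)
qed

lemma unit_normal_parallel: "unit_normal (parallel m) (parallel_normal m)"
proof -
  have "smooth_on UNIV (parallel_normal m)"
    unfolding parallel_normal_eq[abs_def] using hyp
    by (intro smooth_on_affine) (simp add: hypersurface_def)
  moreover have "lorentz_inner (parallel m x) (parallel_normal m x) = 0" for x
    by (simp add: parallel_def parallel_normal_def lorentz_simps products)
  moreover have "lorentz_inner (parallel_normal m x) (parallel_normal m x) = 1" for x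
  proof -
    have "lorentz_inner (parallel_normal m x) (parallel_normal m x) = (cosh m)\<^sup>2 - (sinh m)\<^sup>2"
      by (simp add: parallel_normal_def lorentz_simps products power2_eq_square)
    then show ?thesis by (simp add: cosh_square_eq)
  qed
  moreover have "lorentz_inner (frechet_derivative (parallel m) (at x) v) (parallel_normal m x) = 0" for x v
  proof -
    have N: "lorentz_inner (frechet_derivative F (at x) v) (N x) = 0"
      using normal by (simp add: unit_normal_def)
    have "lorentz_inner (frechet_derivative F (at x) v) (F x) = 0"
      by (rule hypersurface_derivative_tangent[OF hyp])
    with N show ?thesis
      by (simp add: frechet_derivative_parallel parallel_normal_def lorentz_simps)
  qed
  ultimately show ?thesis by (simp add: unit_normal_def)
qed

lemma unit_normal_scaleR_parallel:
  assumes s: "s = 1 \<or> s = -1"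
  shows "unit_normal (parallel m) (\<lambda>x. s *\<^sub>R parallel_normal m x)"
proof -
  have "smooth_on UNIV (\<lambda>x. s *\<^sub>R parallel_normal m x + 0)"
    using unit_normal_parallel by (intro smooth_on_affine) (simp add: unit_normal_def)
  then show ?thesis
    using unit_normal_parallel s by (auto simp: unit_normal_def lorentz_simps)
qed

lemma mean_curvature_parallel:
  assumes s: "s = 1 \<or> s = -1"
  shows "mean_curvature (parallel m) (\<lambda>x. s *\<^sub>R parallel_normal m x) x = real CARD('n) * (s * k)"
proof (rule umbilic_mean_curvature[OF hypersurface_parallel unit_normal_scaleR_parallel[OF s]])
  show "principal_curvatures (parallel m) (\<lambda>x. s *\<^sub>R parallel_normal m x) x (\<lambda>_. s * k)"
    using principal_curvatures_affine[OF isom, of "exp (- k * m)" "(k * sinh m) *\<^sub>R center"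
      "- s * k * exp (- k * m)" "(s * k * cosh m) *\<^sub>R center" x]
    by (simp add: parallel_eq[abs_def] parallel_normal_eq[abs_def] algebra_simps)
qed

text \<open>
  For \<open>k = -1\<close> the normal carried along from \<open>N\<close> points outward and has to be reversed. Both
  directions matter: one verifies that the flow equation holds, the other identifies the normal
  used by an arbitrary solution.
\<close>

lemma inward_unit_normal_parallel_iff:
  "inward_unit_normal (parallel m) \<nu> \<longleftrightarrow> \<nu> = (\<lambda>x. k *\<^sub>R parallel_normal m x)"
proof
  assume "\<nu> = (\<lambda>x. k *\<^sub>R parallel_normal m x)"
  then show "inward_unit_normal (parallel m) \<nu>"
    by (simp add: inward_unit_normal_def unit_normal_scaleR_parallel k mean_curvature_parallel k_sq)
next
  assume \<nu>: "inward_unit_normal (parallel m) \<nu>"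
  then obtain s where s: "s = 1 \<or> s = -1" and "\<And>x. \<nu> x = s *\<^sub>R parallel_normal m x"
    using unit_normal_unique[OF hypersurface_parallel unit_normal_parallel]
    unfolding inward_unit_normal_def by metis
  then have \<nu>_eq: "\<nu> = (\<lambda>x. s *\<^sub>R parallel_normal m x)" by auto
  have "mean_curvature (parallel m) \<nu> 0 > 0" using \<nu> by (simp add: inward_unit_normal_def)
  then have "s * k > 0"
    unfolding \<nu>_eq mean_curvature_parallel[OF s] by (simp add: zero_less_mult_iff)
  then have "s = k" using s k by auto
  with \<nu>_eq show "\<nu> = (\<lambda>x. k *\<^sub>R parallel_normal m x)" by simp
qed

lemma has_vector_derivative_parallel:
  assumes "(\<mu> has_real_derivative d) (at t)"
  shows "((\<lambda>t. parallel (\<mu> t) x) has_vector_derivative d *\<^sub>R parallel_normal (\<mu> t) x) (at t)"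
  unfolding parallel_def parallel_normal_def
  using assms
  by (auto intro!: derivative_eq_intros simp: has_real_derivative_iff_has_vector_derivative[symmetric] algebra_simps)

text \<open>
  A lightlike vector \<open>\<xi>\<close> that cuts out the horosphere is orthogonal to all tangent vectors, so it is
  \<open>- c F + b N\<close> at each point, and being lightlike forces \<open>b = \<plusminus> c\<close>. One sign makes it a
  multiple of \<open>center\<close>. With the other one, \<open>F - k N\<close> would be constant in addition to \<open>F + k N\<close>,
  and \<open>F\<close> could not be an immersion.
\<close>

lemma horosphere_center:
  assumes F: "horosphere (range F)"
  shows "range F = {x \<in> hyperbolic_space. lorentz_inner x center = -1}"
proof -
  obtain \<xi> c where \<xi>: "lorentz_inner \<xi> \<xi> = 0" and c: "c < 0"
    and range: "range F = {x \<in> hyperbolic_space. lorentz_inner x \<xi> = c}"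
    using F unfolding horosphere_def by blast
  have F\<xi>: "lorentz_inner (F x) \<xi> = c" for x using range by blast
  \<comment> \<open>the product with the normal is the same at all points, since \<open>F + k N\<close> is constant\<close>
  define b where "b = k * (lorentz_inner center \<xi> - c)"
  have N\<xi>: "lorentz_inner (N x) \<xi> = b" for x
    by (simp add: N_eq lorentz_simps F\<xi> b_def)
  have \<xi>_eq: "\<xi> = - c *\<^sub>R F x + b *\<^sub>R N x" for x
  proof -
    have "\<xi> + c *\<^sub>R F x - b *\<^sub>R N x = 0"
    proof (rule hypersurface_orthogonal_imp_zero[OF hyp normal, of _ x])
      fix v
      have "lorentz_inner (frechet_derivative F (at x) v) \<xi> = 0"
        using derivative_lorentz_inner_const[OF dF has_derivative_const F\<xi>, of x v]
        by (simp add: lorentz_simps)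
      moreover have "lorentz_inner (frechet_derivative F (at x) v) (N x) = 0"
        using normal by (simp add: unit_normal_def)
      ultimately show "lorentz_inner (\<xi> + c *\<^sub>R F x - b *\<^sub>R N x) (frechet_derivative F (at x) v) = 0"
        using hypersurface_derivative_tangent[OF hyp, of x v]
        by (simp add: lorentz_simps lorentz_inner_commute[of _ "frechet_derivative F (at x) v"])
    qed (simp_all add: lorentz_simps products lorentz_inner_commute[of \<xi>] F\<xi> N\<xi>)
    then show ?thesis by (simp add: algebra_simps)
  qed
  have "b * b - c * c = 0"
    using \<xi> by (simp add: \<xi>_eq[of 0] lorentz_simps products)
  then have "(b - c * k) * (b + c * k) = 0"
    using k by (auto simp: algebra_simps)
  moreover have "b \<noteq> c * k"
  proof
    assume b: "b = c * k"
    have "c *\<^sub>R (2 *\<^sub>R F x) = c *\<^sub>R center - \<xi>" for x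
      by (simp add: \<xi>_eq[of x] center_eq[of x, symmetric] b algebra_simps scaleR_2)
    then have "c *\<^sub>R (2 *\<^sub>R F x) = c *\<^sub>R (2 *\<^sub>R F 0)" for x by simp
    then have "F = (\<lambda>x. F 0)" using c by auto
    then have "frechet_derivative F (at 0) = (\<lambda>v. 0)"
      by (metis frechet_derivative_const)
    moreover have "inj (frechet_derivative F (at 0))" using hyp by (simp add: hypersurface_def)
    ultimately have "(axis undefined 1 :: real ^ 'n) = 0" by (metis injD)
    then show False by simp
  qed
  ultimately have "b = - c * k" by simp
  then have "\<xi> = - c *\<^sub>R center"
    by (simp add: \<xi>_eq[of 0] center_def algebra_simps)
  then have "lorentz_inner y \<xi> = c \<longleftrightarrow> lorentz_inner y center = -1" for y
    using c by (auto simp: lorentz_simps minus_equation_iff[of _ c] mult_less_0_iff)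
       (metis mult.right_neutral mult_left_cancel mult_minus_right less_irrefl)
  then show ?thesis using range by simp
qed

text \<open>
  Displacement by \<open>m\<close> maps the level \<open>-1\<close> of the product with \<open>center\<close> to the level
  \<open>- exp (- k * m)\<close>. That every point of the second level is reached is seen by inverting the affine
  map of \<open>parallel_eq\<close> and checking that the preimage lies on the hyperboloid.
\<close>

lemma horosphere_parallel:
  assumes F: "horosphere (range F)"
  shows "horosphere (range (parallel m))"
proof -
  have "range (parallel m) = {y \<in> hyperbolic_space. lorentz_inner y center = - exp (- k * m)}"
  proof (intro equalityI subsetI)
    fix y assume "y \<in> range (parallel m)"
    then show "y \<in> {y \<in> hyperbolic_space. lorentz_inner y center = - exp (- k * m)}"
      using parallel_in_hyperbolic_space parallel_center by auto
  next
    fix y assume "y \<in> {y \<in> hyperbolic_space. lorentz_inner y center = - exp (- k * m)}"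
    then have y: "lorentz_inner y y = -1" "lorentz_inner y center = - exp (- k * m)"
      by (simp_all add: hyperbolic_space_def)
    \<comment> \<open>the solution of \<open>exp (- k * m) x + k sinh m center = y\<close>\<close>
    define x where "x = exp (k * m) *\<^sub>R (y - (k * sinh m) *\<^sub>R center)"
    have e: "exp (k * m) * exp (- k * m) = 1" by (simp flip: exp_add)
    have sinh: "k * sinh m = (exp (k * m) - exp (- k * m)) / 2"
      using k by (elim disjE) (simp_all add: sinh_def field_simps)
    have "lorentz_inner x x = (exp (k * m))\<^sup>2 * (-1 + 2 * (k * sinh m) * exp (- k * m))"
      by (simp add: x_def lorentz_simps center_lightlike lorentz_inner_commute[of center y] y power2_eq_square)
         (simp add: algebra_simps)
    also have "\<dots> = (exp (k * m))\<^sup>2 * (-1 + (exp (k * m) - exp (- k * m)) * exp (- k * m))"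
      by (simp only: sinh) simp
    also have "\<dots> = (exp (k * m))\<^sup>2 * (-1) + (exp (k * m) * exp (- k * m)) * (exp (k * m))\<^sup>2
        - (exp (k * m) * exp (- k * m))\<^sup>2"
      by (simp only: algebra_simps power2_eq_square)
    also have "\<dots> = -1" unfolding e by simp
    finally have xx: "lorentz_inner x x = -1" .
    have xc: "lorentz_inner x center = -1"
      using e y by (simp add: x_def lorentz_simps center_lightlike)
    have "fst x > 0"
      by (rule causal_future_pointing[of _ center])
         (simp_all add: xx xc center_lightlike center_future)
    then have "x \<in> range F"
      using xx xc by (simp add: horosphere_center[OF F] hyperbolic_space_def)
    then obtain z where "F z = x" by auto
    then have "parallel m z = y"
      using e by (simp add: parallel_eq x_def mult.commute)
    then show "y \<in> range (parallel m)" by auto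
  qed
  then show ?thesis
    unfolding horosphere_def using center_lightlike center_future
    by (intro exI[of _ center] exI[of _ "- exp (- k * m)"]) simp
qed

section \<open>The inverse mean curvature flow\<close>

text \<open>
  The prescribed velocity does not depend on the displacement except through the normal, which turns
  the flow into an ordinary differential equation for the displacement, with constant right-hand side.
\<close>

lemma imcf_velocity_parallel:
  assumes "inward_unit_normal (parallel m) \<nu>"
  shows "- ((1 / mean_curvature (parallel m) \<nu> x) *\<^sub>R \<nu> x)
      = (- k / real CARD('n)) *\<^sub>R parallel_normal m x"
  using assms
  by (simp add: inward_unit_normal_parallel_iff mean_curvature_parallel[OF k] k_sq)

lemma imcf_parallel:
  "imcf_solution_by_parallel UNIV (\<lambda>t. parallel (- k * t / real CARD('n))) F N"
proof -
  let ?n = "real CARD('n)"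
  have "\<exists>Nt. inward_unit_normal (parallel (- k * t / ?n)) Nt \<and>
      (\<forall>x. ((\<lambda>s. parallel (- k * s / ?n) x) has_vector_derivative
         - ((1 / mean_curvature (parallel (- k * t / ?n)) Nt x) *\<^sub>R Nt x)) (at t))" for t
  proof (intro exI conjI allI)
    show *: "inward_unit_normal (parallel (- k * t / ?n)) (\<lambda>x. k *\<^sub>R parallel_normal (- k * t / ?n) x)"
      by (simp add: inward_unit_normal_parallel_iff)
    have "((\<lambda>s. - k * s / ?n) has_real_derivative - k / ?n) (at t)"
      by (auto intro!: derivative_eq_intros)
    from has_vector_derivative_parallel[OF this]
    show "((\<lambda>s. parallel (- k * s / ?n) x) has_vector_derivative
         - ((1 / mean_curvature (parallel (- k * t / ?n))
            (\<lambda>x. k *\<^sub>R parallel_normal (- k * t / ?n) x) x) *\<^sub>R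
              (k *\<^sub>R parallel_normal (- k * t / ?n) x))) (at t)" for x
      unfolding imcf_velocity_parallel[OF *] .
  qed
  moreover have "smooth_on UNIV (\<lambda>t. - k * t / ?n)"
    using smooth_on_affine[OF smooth_on_ident[where 'a=real], of "- k / ?n" 0] by simp
  moreover have "parallel (- k * 0 / ?n) = F"
    by (simp add: parallel_def fun_eq_iff)
  ultimately show ?thesis
    unfolding imcf_solution_by_parallel_def imcf_solution_def
    using hypersurface_parallel
    by (auto simp: parallel_def)
qed

text \<open>
  The velocity of any solution by parallel hypersurfaces with displacement \<open>\<mu>\<close> is \<open>\<mu>'\<close> times the
  carried normal, and comparison with the prescribed velocity determines \<open>\<mu>'\<close>. The initial condition
  supplies \<open>\<mu> 0 = 0\<close> and the interval \<open>I\<close> is connected.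
\<close>

lemma imcf_parallel_unique:
  assumes sol: "imcf_solution_by_parallel I Gt F N" and t: "t \<in> I"
  shows "Gt t x = parallel (- k * t / real CARD('n)) x"
proof -
  let ?n = "real CARD('n)"
  obtain \<mu> where \<mu>: "smooth_on I \<mu>" and "\<And>t x. t \<in> I \<Longrightarrow> Gt t x = parallel (\<mu> t) x"
    using sol unfolding imcf_solution_by_parallel_def parallel_def by blast
  then have G: "\<And>t. t \<in> I \<Longrightarrow> Gt t = parallel (\<mu> t)" by auto
  have I: "open I" "is_interval I" "0 \<in> I" and G0: "Gt 0 = F"
    and flow: "\<And>t. t \<in> I \<Longrightarrow> \<exists>Nt. inward_unit_normal (Gt t) Nt \<and>
        (\<forall>x. ((\<lambda>s. Gt s x) has_vector_derivative
                 - ((1 / mean_curvature (Gt t) Nt x) *\<^sub>R Nt x)) (at t))"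
    using sol unfolding imcf_solution_by_parallel_def imcf_solution_def by blast+
  have d\<mu>: "(\<mu> has_real_derivative - k / ?n) (at t)" if t: "t \<in> I" for t
  proof -
    obtain d where d: "(\<mu> has_real_derivative d) (at t)"
      using smooth_on_imp_differentiable[OF \<mu> t] real_differentiable_def by blast
    obtain Nt where Nt: "inward_unit_normal (parallel (\<mu> t)) Nt"
      and "((\<lambda>s. Gt s 0) has_vector_derivative
                 - ((1 / mean_curvature (parallel (\<mu> t)) Nt 0) *\<^sub>R Nt 0)) (at t)"
      using flow[OF t] unfolding G[OF t] by blast
    then have "((\<lambda>s. Gt s 0) has_vector_derivative
        (- k / ?n) *\<^sub>R parallel_normal (\<mu> t) 0) (at t)"
      unfolding imcf_velocity_parallel[OF Nt] by blast
    then have "((\<lambda>s. parallel (\<mu> s) 0) has_vector_derivative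
        (- k / ?n) *\<^sub>R parallel_normal (\<mu> t) 0) (at t)"
      by (rule has_vector_derivative_transform_within_open[OF _ I(1) t]) (simp add: G)
    from vector_derivative_unique_at[OF this has_vector_derivative_parallel[OF d]]
    have "(- k / ?n - d) *\<^sub>R parallel_normal (\<mu> t) 0 = 0"
      by (simp add: scaleR_left_diff_distrib)
    moreover have "parallel_normal (\<mu> t) 0 \<noteq> 0"
      using unit_normal_parallel[of "\<mu> t"] unfolding unit_normal_def
      by (metis lorentz.zero_left zero_neq_one)
    ultimately have "d = - k / ?n" by simp
    with d show ?thesis by simp
  qed
  have "((\<lambda>t. \<mu> t + k * t / ?n) has_real_derivative 0) (at t within I)" if "t \<in> I" for t
    by (rule has_field_derivative_at_within) (auto intro!: derivative_eq_intros d\<mu> that)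
  then obtain c where c: "\<And>t. t \<in> I \<Longrightarrow> \<mu> t + k * t / ?n = c"
    using has_field_derivative_zero_constant[of I "\<lambda>t. \<mu> t + k * t / ?n"] is_interval_convex[OF I(2)]
    by blast
  \<comment> \<open>the product with \<open>N\<close> isolates \<open>sinh (\<mu> 0)\<close>\<close>
  have "lorentz_inner (parallel (\<mu> 0) 0) (N 0) = lorentz_inner (F 0) (N 0)"
    using G[OF I(3)] G0 by simp
  then have "\<mu> 0 = 0" by (simp add: parallel_def lorentz_simps products)
  then have "\<mu> t = - k * t / ?n" using c[OF I(3)] c[OF t] by simp
  then show ?thesis by (simp add: G[OF t])
qed

section \<open>Limits in the Poincare ball\<close>

lemma parallel_flow_eq:
  "parallel (- k * t / n) x = exp (t / n) *\<^sub>R F x - sinh (t / n) *\<^sub>R center"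
proof -
  have "- k * (- k * t / n) = t / n" "k * sinh (- k * t / n) = - sinh (t / n)"
    using k by (elim disjE; simp)+
  then show ?thesis unfolding parallel_eq by (simp only:) simp
qed

text \<open>
  With \<open>s = exp (t / n)\<close>, multiplying numerator and denominator of the ball coordinates by \<open>s\<close>
  extends them continuously to \<open>s = 0\<close>, that is, to \<open>t = -\<infinity>\<close>. The value there involves \<open>center\<close>
  alone and has norm one because \<open>center\<close> is lightlike.
\<close>

lemma parallel_converges_to_point:
  assumes n: "n > 0"
  shows "converges_to_point (\<lambda>t. parallel (- k * t / n)) at_bot"
proof -
  define p where "p = (1 / fst center) *\<^sub>R (fst (snd center), - snd (snd center))"
  define A where "A = (\<lambda>x s. s\<^sup>2 *\<^sub>R F x + ((1 - s\<^sup>2) / 2) *\<^sub>R center)"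
  define Q where "Q = (\<lambda>x s. (1 / (fst (A x s) + s)) *\<^sub>R (fst (snd (A x s)), - snd (snd (A x s))))"
  have "norm (fst (snd center), - snd (snd center)) = norm (snd center)"
    by (simp add: norm_prod_def)
  also have "\<dots> = sqrt ((fst center)\<^sup>2)"
    using center_lightlike by (simp add: norm_eq_sqrt_inner lorentz_inner_def power2_eq_square)
  also have "\<dots> = fst center" using center_future by simp
  finally have "norm p = 1" using center_future unfolding p_def norm_scaleR by simp
  then have "p \<in> cball 0 1" by simp
  moreover have "((\<lambda>t. poincare_ball (parallel (- k * t / n) x)) \<longlongrightarrow> p) at_bot" for x
  proof -
    have A: "A x (exp (t / n)) = exp (t / n) *\<^sub>R parallel (- k * t / n) x" for t
    proof -
      have "(1 - (exp (t / n))\<^sup>2) / 2 = - (exp (t / n) * sinh (t / n))"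
        by (simp add: sinh_def right_diff_distrib power2_eq_square diff_divide_distrib flip: exp_add)
      then show ?thesis
        unfolding parallel_flow_eq A_def by (simp add: scaleR_diff_right power2_eq_square)
    qed
    have Q: "poincare_ball (parallel (- k * t / n) x) = Q x (exp (t / n))" for t
      unfolding Q_def A poincare_ball_def
      by (simp add: case_prod_beta flip: distrib_left[of "exp (t / n)" _ 1, simplified])
    have "isCont (Q x) 0"
      unfolding Q_def A_def using center_future by (intro continuous_intros) auto
    moreover have "((\<lambda>t. exp (t / n)) \<longlongrightarrow> 0) at_bot"
      using n by real_asymp
    ultimately have "((\<lambda>t. Q x (exp (t / n))) \<longlongrightarrow> Q x 0) at_bot"
      by (rule isCont_tendsto_compose)
    moreover have "Q x 0 = p" by (simp add: Q_def A_def p_def)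
    ultimately show ?thesis by (simp only: Q)
  qed
  ultimately show ?thesis unfolding converges_to_point_def by blast
qed

text \<open>
  On the hyperboloid the distance to the boundary of the ball is governed by the first coordinate
  alone.
\<close>

lemma norm_poincare_ball:
  assumes "y \<in> hyperbolic_space"
  shows "norm (poincare_ball y) = sqrt ((fst y - 1) / (fst y + 1))"
proof -
  have y: "fst y > 0" and "snd y \<bullet> snd y = (fst y - 1) * (fst y + 1)"
    using assms by (simp_all add: hyperbolic_space_def lorentz_inner_def algebra_simps)
  then have "norm (fst (snd y), - snd (snd y)) = sqrt ((fst y - 1) * (fst y + 1))"
    by (simp add: norm_eq_sqrt_inner inner_prod_def)
  moreover have "poincare_ball y = (1 / (fst y + 1)) *\<^sub>R (fst (snd y), - snd (snd y))"
    by (simp add: poincare_ball_def case_prod_beta)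
  ultimately have "norm (poincare_ball y) = sqrt ((fst y - 1) * (fst y + 1)) / sqrt ((fst y + 1)\<^sup>2)"
    using y by (simp only: norm_scaleR) simp
  also have "\<dots> = sqrt ((fst y - 1) / (fst y + 1))"
    unfolding real_sqrt_divide[symmetric] using y by (simp add: power2_eq_square)
  finally show ?thesis .
qed

text \<open>
  The leading coefficient of the first coordinate is that of \<open>F - center / 2\<close>, a lightlike
  vector with product \<open>-1\<close> with \<open>center\<close>, hence future-pointing.
\<close>

lemma parallel_converges_to_conformal_boundary:
  assumes n: "n > 0"
  shows "converges_to_conformal_boundary (\<lambda>t. parallel (- k * t / n)) at_top"
  unfolding converges_to_conformal_boundary_def
proof
  fix x
  define a where "a = fst (F x) - fst center / 2"
  have "fst (F x - (1/2) *\<^sub>R center) > 0"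
    by (rule causal_future_pointing[of _ center])
       (simp_all add: lorentz_simps products center_lightlike center_future F_center
          lorentz_inner_commute[of center "F x"])
  then have a: "a > 0" by (simp add: a_def)
  have fst: "exp (t / n) * a \<le> fst (parallel (- k * t / n) x)" for t
  proof -
    have "fst (parallel (- k * t / n) x) = exp (t / n) * a + exp (- (t / n)) * fst center / 2"
      unfolding parallel_flow_eq by (simp add: a_def sinh_def field_simps)
    then show ?thesis using center_future by simp
  qed
  have "filterlim (\<lambda>t. exp (t / n) * a) at_top at_top"
    using n a by real_asymp
  then have lim: "filterlim (\<lambda>t. fst (parallel (- k * t / n) x)) at_top at_top"
    by (rule filterlim_at_top_mono) (intro always_eventually allI fst)
  have "((\<lambda>r :: real. sqrt ((r - 1) / (r + 1))) \<longlongrightarrow> 1) at_top"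
    by real_asymp
  from filterlim_compose[OF this lim]
  show "((\<lambda>t. norm (poincare_ball (parallel (- k * t / n) x))) \<longlongrightarrow> 1) at_top"
    by (simp add: norm_poincare_ball[OF parallel_in_hyperbolic_space])
qed

end

section \<open>Eternal flow of a horosphere\<close>

theorem theorem3p3:
  fixes F N :: "real ^ 'n \<Rightarrow> 'n::finite lorentz"
    and k :: real
  assumes "isometric_immersion F"
    and "horosphere (range F)"
    and "unit_normal F N"
    and "\<exists>\<nu>. inward_unit_normal F \<nu>"
    and "k = 1 \<or> k = -1"
    and "\<forall>x. principal_curvatures F N x (\<lambda>_. k)"
  shows "let n = real CARD('n);
             Ft = (\<lambda>t x. cosh (- k * t / n) *\<^sub>R F x + sinh (- k * t / n) *\<^sub>R N x)
         in imcf_solution_by_parallel UNIV Ft F N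
          \<and> (\<forall>I Gt. imcf_solution_by_parallel I Gt F N \<longrightarrow> (\<forall>t\<in>I. \<forall>x. Gt t x = Ft t x))
          \<and> (\<forall>t. horosphere (range (Ft t)))
          \<and> converges_to_point Ft at_bot
          \<and> converges_to_conformal_boundary Ft at_top"
proof -
  interpret horospherical_immersion F N k
    by unfold_locales (use assms in auto)
  have Ft: "(\<lambda>t x. cosh (- k * t / n) *\<^sub>R F x + sinh (- k * t / n) *\<^sub>R N x)
      = (\<lambda>t. parallel (- k * t / n))" for n
    by (simp add: parallel_def fun_eq_iff)
  show ?thesis
    unfolding Let_def Ft
  proof (intro conjI allI impI ballI)
    show "imcf_solution_by_parallel UNIV (\<lambda>t. parallel (- k * t / real CARD('n))) F N"
      by (rule imcf_parallel)
    show "Gt t x = parallel (- k * t / real CARD('n)) x"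
      if "imcf_solution_by_parallel I Gt F N" "t \<in> I" for I Gt t x
      using that by (rule imcf_parallel_unique)
    show "horosphere (range (parallel (- k * t / real CARD('n))))" for t
      by (rule horosphere_parallel[OF assms(2)])
    show "converges_to_point (\<lambda>t. parallel (- k * t / real CARD('n))) at_bot"
      by (rule parallel_converges_to_point) simp
    show "converges_to_conformal_boundary (\<lambda>t. parallel (- k * t / real CARD('n))) at_top"
      by (rule parallel_converges_to_conformal_boundary) simp
  qed
qed

end
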